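(* Let $A$ be a totally ordered alphabet, and let $u=u_1\cdots u_k$ and $v=v_1\cdots v_l$ be nonempty words over $A$ with $\mathrm{alph}(u)\cap\mathrm{alph}(v)=\emptyset$. Then $\langle u\prec v\rangle=\langle\sigma\prec\tau\rangle$, where $\sigma=\mathrm{std}(u)$ and $\tau=\mathrm{std}(v)[k]$ if $u_k<v_l$, and $\sigma=\mathrm{std}(u)[l]$ and $\tau=\mathrm{std}(v)$ if $u_k>v_l$.
   Context: Shuffle product: $\sqcup\!\sqcup$ on $\mathbb K\langle A\rangle$. For nonempty words $u=u'a$, $v=v'b$ ($a,b$ letters), the left half-shuffle is $u\prec v=(u'\sqcup\!\sqcup v)\,a$ (a sum of words, with multiplicities). $\mathrm{std}(w)$ is the standardized word of $w$: label the occurrences of the smallest letter $1,2,\dots$ from left to right, then those of the next letter, and so on. For a word $w$ over positive integers, $w[k]$ is obtained by adding $k$ to every letter. For a word $w=w_1\cdots w_N$, $D(w)$ is the composition of $N$ with descent set $\{i:w_i>w_{i+1}\}$, $\langle w\rangle:=F_{D(w)}(X)$ (Gessel's fundamental quasi-symmetric function), extended linearly. $\mathrm{alph}(w)$ is the set of letters of $w$. *)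

theory Defs
  imports Complex_Main "HOL-Library.Poly_Mapping"
begin

text \<open>The algebra \<open>K\<langle>A\<rangle>\<close> is represented by \<open>'a list \<Rightarrow>\<^sub>0 'k\<close>: finitely supported
  functions on words. \<open>nc_mult\<close> is the concatenation product.\<close>

definition nc_mult ::
    "('a list \<Rightarrow>\<^sub>0 'k::comm_semiring_1) \<Rightarrow> ('a list \<Rightarrow>\<^sub>0 'k) \<Rightarrow> ('a list \<Rightarrow>\<^sub>0 'k)" where
  "nc_mult P Q = (\<Sum>u\<in>Poly_Mapping.keys P. \<Sum>v\<in>Poly_Mapping.keys Q.
     Poly_Mapping.single (u @ v) (Poly_Mapping.lookup P u * Poly_Mapping.lookup Q v))"

fun shuffle :: "'a list \<Rightarrow> 'a list \<Rightarrow> ('a list \<Rightarrow>\<^sub>0 'k::comm_semiring_1)" where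
  "shuffle [] v = Poly_Mapping.single v 1"
| "shuffle (a # u) [] = Poly_Mapping.single (a # u) 1"
| "shuffle (a # u) (b # v) =
     nc_mult (Poly_Mapping.single [a] 1) (shuffle u (b # v)) +
     nc_mult (Poly_Mapping.single [b] 1) (shuffle (a # u) v)"

text \<open>Only meaningful for nonempty words.\<close>

definition half_shuffle ::
    "'a list \<Rightarrow> 'a list \<Rightarrow> ('a list \<Rightarrow>\<^sub>0 'k::comm_semiring_1)" (infix \<open>\<prec>\<close> 70) where
  "u \<prec> v = nc_mult (shuffle (butlast u) v) (Poly_Mapping.single [last u] 1)"

text \<open>The label given to position \<open>i\<close> is the number of positions labelled no later than \<open>i\<close>:
  those carrying a smaller letter, and those carrying the same letter weakly to the left.\<close>

definition std :: "'a::linorder list \<Rightarrow> nat list" where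
  "std w = map (\<lambda>i. card {j. j < length w \<and> (w ! j < w ! i \<or> w ! j = w ! i \<and> j \<le> i)})
     [0..<length w]"

definition shift :: "nat list \<Rightarrow> nat \<Rightarrow> nat list" where
  "shift w k = map (\<lambda>a. a + k) w"

text \<open>Descent sets use the positions \<open>1, \<dots>, N - 1\<close>, whereas list indices start at 0.\<close>

definition descents :: "'a::linorder list \<Rightarrow> nat set" where
  "descents w = {i. 1 \<le> i \<and> i < length w \<and> w ! (i - 1) > w ! i}"

definition is_composition :: "nat \<Rightarrow> nat list \<Rightarrow> bool" where
  "is_composition N I \<longleftrightarrow> (\<forall>p\<in>set I. 0 < p) \<and> sum_list I = N"

definition comp_descents :: "nat list \<Rightarrow> nat set" where
  "comp_descents I = {sum_list (take j I) | j. 1 \<le> j \<and> j < length I}"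

definition descent_comp :: "'a::linorder list \<Rightarrow> nat list" where
  "descent_comp w = (THE I. is_composition (length w) I \<and> comp_descents I = descents w)"

text \<open>A formal power series in the commuting variables \<open>X = {x\<^sub>0 < x\<^sub>1 < \<dots>}\<close> is its coefficient
  function on monomials, a monomial being its exponent vector \<open>nat \<Rightarrow>\<^sub>0 nat\<close>.
  The series \<open>F\<^sub>I\<close> is the sum of \<open>x\<^bsub>i\<^sub>1\<^esub> \<cdots> x\<^bsub>i\<^sub>N\<^esub>\<close> over all \<open>i\<^sub>1 \<le> \<cdots> \<le> i\<^sub>N\<close> with
  \<open>i\<^sub>j < i\<^bsub>j+1\<^esub>\<close> whenever \<open>j\<close> lies in the descent set of \<open>I\<close>; its coefficient at a monomial
  counts the index sequences producing that monomial.\<close>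

type_synonym 'k series = "(nat \<Rightarrow>\<^sub>0 nat) \<Rightarrow> 'k"

definition index_seqs :: "nat list \<Rightarrow> nat list set" where
  "index_seqs I = {s. length s = sum_list I \<and>
     (\<forall>j. 1 \<le> j \<and> j < length s \<longrightarrow>
        s ! (j - 1) \<le> s ! j \<and> (j \<in> comp_descents I \<longrightarrow> s ! (j - 1) < s ! j))}"

definition monomial_of :: "nat list \<Rightarrow> (nat \<Rightarrow>\<^sub>0 nat)" where
  "monomial_of s = (\<Sum>i\<leftarrow>s. Poly_Mapping.single i 1)"

definition fundamental_qsym :: "nat list \<Rightarrow> 'k::comm_semiring_1 series" where
  "fundamental_qsym I m = of_nat (card {s \<in> index_seqs I. monomial_of s = m})"

definition bracket :: "('a::linorder list \<Rightarrow>\<^sub>0 'k::comm_semiring_1) \<Rightarrow> 'k series" (\<open>\<langle>_\<rangle>\<close>) where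
  "\<langle>P\<rangle> m = (\<Sum>w\<in>Poly_Mapping.keys P.
     Poly_Mapping.lookup P w * fundamental_qsym (descent_comp w) m)"

lemma finite_monomial_fibre: "finite {s \<in> index_seqs I. monomial_of s = m}"
proof -
  have sub: "set s \<subseteq> Poly_Mapping.keys (monomial_of s)" for s
  proof (induction s)
    case (Cons a s)
    then show ?case
      by (auto simp: monomial_of_def in_keys_iff lookup_add lookup_single subset_iff)
  qed simp
  have "{s \<in> index_seqs I. monomial_of s = m}
      \<subseteq> {s. set s \<subseteq> Poly_Mapping.keys m \<and> length s = sum_list I}"
    using sub by (auto simp: index_seqs_def)
  then show ?thesis
    by (rule finite_subset) (simp add: finite_lists_length_eq)
qed

lemma comp_descents_Cons:
  "comp_descents (p # I) = (if I = [] then {} else insert p ((+) p ` comp_descents I))"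
proof (cases "I = []")
  case False
  have "comp_descents (p # I) = {sum_list (take (Suc j) (p # I)) | j. j < length I}"
    unfolding comp_descents_def
    by (auto simp: Suc_le_eq gr0_conv_Suc) (metis Suc_less_eq le_numeral_extra(4) length_Cons less_Suc_eq_0_disj nat.simps(3) take_Suc_Cons sum_list.Cons)+
  also have "\<dots> = {p + sum_list (take j I) | j. j < length I}" by simp
  also have "\<dots> = insert p ((+) p ` comp_descents I)"
  proof (intro set_eqI iffI)
    fix x assume "x \<in> {p + sum_list (take j I) | j. j < length I}"
    then obtain j where "x = p + sum_list (take j I)" "j < length I" by blast
    then show "x \<in> insert p ((+) p ` comp_descents I)"
      by (cases j) (auto simp: comp_descents_def)
  next
    fix x assume "x \<in> insert p ((+) p ` comp_descents I)"
    then consider "x = p" | j where "x = p + sum_list (take j I)" "j < length I"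
      by (auto simp: comp_descents_def)
    then show "x \<in> {p + sum_list (take j I) | j. j < length I}"
    proof cases
      case 1
      then have "x = p + sum_list (take 0 I)" by simp
      then show ?thesis using False by blast
    qed blast
  qed
  finally show ?thesis using False by simp
qed (simp add: comp_descents_def)

lemma composition_unique:
  assumes "is_composition N I" "is_composition N J" "comp_descents I = comp_descents J"
  shows "I = J"
  using assms
proof (induction I arbitrary: N J)
  case Nil
  then show ?case by (cases J) (auto simp: is_composition_def)
next
  case (Cons p I)
  then obtain q J' where J: "J = q # J'" by (cases J) (auto simp: is_composition_def)
  have eq: "I = [] \<longleftrightarrow> J' = []"
    using Cons.prems(3) unfolding J comp_descents_Cons by (auto split: if_splits)
  show ?case
  proof (cases "I = []")
    case True
    then show ?thesis using eq Cons.prems by (auto simp: J is_composition_def)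
  next
    case False
    then have e: "insert p ((+) p ` comp_descents I) = insert q ((+) q ` comp_descents J')"
      using eq Cons.prems(3) by (simp add: J comp_descents_Cons)
    have pos: "0 < x" if "x \<in> comp_descents K" "\<forall>p\<in>set K. 0 < p" for x K
    proof -
      from that(1) obtain j where "x = sum_list (take j K)" "1 \<le> j" "j < length K"
        by (auto simp: comp_descents_def)
      then show ?thesis using that(2) by (cases K; cases j) auto
    qed
    have posI: "\<And>x. x \<in> comp_descents I \<Longrightarrow> 0 < x" and posJ: "\<And>x. x \<in> comp_descents J' \<Longrightarrow> 0 < x"
      using pos Cons.prems by (auto simp: is_composition_def J)
    have "p \<in> insert q ((+) q ` comp_descents J')" "q \<in> insert p ((+) p ` comp_descents I)"
      using e by blast+
    then have pq: "p = q" by auto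
    have np: "p \<notin> (+) p ` comp_descents I" "p \<notin> (+) p ` comp_descents J'"
      using posI posJ by (auto simp: image_iff)
    have "(+) p ` comp_descents I = (+) p ` comp_descents J'"
      using e np by (simp add: pq insert_ident)
    then have "comp_descents I = comp_descents J'" by (simp add: inj_image_eq_iff)
    moreover have "is_composition (N - p) I" "is_composition (N - p) J'"
      using Cons.prems by (auto simp: is_composition_def J pq)
    ultimately show ?thesis using Cons.IH J pq by blast
  qed
qed

lemma composition_exists:
  assumes "S \<subseteq> {1..<N}"
  shows "\<exists>I. is_composition N I \<and> comp_descents I = S"
  using assms
proof (induction N arbitrary: S rule: less_induct)
  case (less N)
  show ?case
  proof (cases "S = {}")
    case True
    show ?thesis
    proof (cases "N = 0")
      case True
      then show ?thesis using \<open>S = {}\<close>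
        by (intro exI[of _ "[]"]) (simp add: is_composition_def comp_descents_def)
    next
      case False
      then show ?thesis using \<open>S = {}\<close>
        by (intro exI[of _ "[N]"]) (simp add: is_composition_def comp_descents_def)
    qed
  next
    case False
    define p where "p = Min S"
    have fin: "finite S" using less.prems finite_subset by blast
    have pS: "p \<in> S" and le: "\<And>x. x \<in> S \<Longrightarrow> p \<le> x"
      using False fin by (auto simp: p_def)
    have p: "0 < p" "p < N" using pS less.prems by auto
    define T where "T = (\<lambda>x. x - p) ` (S - {p})"
    have T: "T \<subseteq> {1..<N - p}"
    proof
      fix y assume "y \<in> T"
      then obtain x where "x \<in> S" "x \<noteq> p" "y = x - p" by (auto simp: T_def)
      then show "y \<in> {1..<N - p}" using le[of x] less.prems by fastforce
    qed
    then obtain I where I: "is_composition (N - p) I" "comp_descents I = T"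
      using less.IH[of "N - p" T] p by auto
    have "I \<noteq> []" using I p by (auto simp: is_composition_def)
    moreover have "insert p ((+) p ` T) = S"
    proof -
      have "(+) p ` T = (\<lambda>x. x) ` (S - {p})"
        unfolding T_def image_image by (rule image_cong) (auto simp: le)
      then show ?thesis using pS by auto
    qed
    ultimately have "comp_descents (p # I) = S" using I by (simp add: comp_descents_Cons)
    moreover have "is_composition N (p # I)" using I p by (auto simp: is_composition_def)
    ultimately show ?thesis by blast
  qed
qed

lemma descent_comp:
  "is_composition (length w) (descent_comp w)" "comp_descents (descent_comp w) = descents w"
proof -
  have "descents w \<subseteq> {1..<length w}" by (auto simp: descents_def)
  then have "\<exists>!I. is_composition (length w) I \<and> comp_descents I = descents w"
    using composition_exists composition_unique by metis
  from theI'[OF this] show "is_composition (length w) (descent_comp w)"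
    "comp_descents (descent_comp w) = descents w" by (auto simp: descent_comp_def)
qed

end

theory Submission
  imports Defs "HOL-Library.Multiset" "HOL-Library.Product_Lexorder"
begin

text \<open>A sequence \<open>s\<close> contributes to \<open>F\<^bsub>D(w)\<^esub>\<close> iff the list of pairs \<open>zip s w\<close> is sorted
  lexicographically. For disjoint alphabets, a sorted list over a shuffle of \<open>u\<close> and \<open>v\<close> is thus
  the merge of a unique pair of sorted lists \<open>zip f u\<close> and \<open>zip g v\<close>, and it ends with a letter
  of \<open>u\<close> iff the last entry of \<open>zip g v\<close> lies below that of \<open>zip f u\<close>. Hence \<open>\<langle>u \<prec> v\<rangle>\<close> depends
  only on the lengths and descent sets of \<open>u\<close> and \<open>v\<close> and on the comparison of their last letters,
  all of which standardization with the prescribed shift preserves.\<close>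

section \<open>Multiplicity-free word sums and shuffles over disjoint alphabets\<close>

text \<open>Over disjoint alphabets every word of a shuffle has coefficient 1, so polynomials can be
  traded for finite sets of words; this is the indicator polynomial of such a set.\<close>

definition word_sum :: "'a list set \<Rightarrow> ('a list \<Rightarrow>\<^sub>0 'k::comm_semiring_1)" where
  "word_sum S = (\<Sum>w\<in>S. Poly_Mapping.single w 1)"

lemma lookup_word_sum:
  "finite S \<Longrightarrow> Poly_Mapping.lookup (word_sum S :: 'a list \<Rightarrow>\<^sub>0 'k::comm_semiring_1) w = of_bool (w \<in> S)"
  by (simp add: word_sum_def lookup_sum lookup_single when_def sum.delta' of_bool_def)

lemma keys_word_sum:
  "finite S \<Longrightarrow> Poly_Mapping.keys (word_sum S :: 'a list \<Rightarrow>\<^sub>0 'k::comm_semiring_1) = S"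
  by (auto simp: in_keys_iff lookup_word_sum)

lemma word_sum_Un:
  "finite S \<Longrightarrow> finite T \<Longrightarrow> S \<inter> T = {} \<Longrightarrow> word_sum (S \<union> T) = word_sum S + word_sum T"
  by (simp add: word_sum_def sum.union_disjoint)

lemma nc_mult_single_word_sum:
  assumes "finite S"
  shows "nc_mult (Poly_Mapping.single x 1) (word_sum S :: 'a list \<Rightarrow>\<^sub>0 'k::comm_semiring_1)
    = word_sum ((@) x ` S)"
proof -
  have "nc_mult (Poly_Mapping.single x 1) (word_sum S :: 'a list \<Rightarrow>\<^sub>0 'k) = (\<Sum>w\<in>S. Poly_Mapping.single (x @ w) 1)"
    using assms by (simp add: nc_mult_def keys_word_sum lookup_word_sum)
  then show ?thesis
    by (simp add: word_sum_def sum.reindex inj_on_def)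
qed

lemma nc_mult_word_sum_single:
  assumes "finite S"
  shows "nc_mult (word_sum S :: 'a list \<Rightarrow>\<^sub>0 'k::comm_semiring_1) (Poly_Mapping.single x 1)
    = word_sum ((\<lambda>w. w @ x) ` S)"
proof -
  have "nc_mult (word_sum S :: 'a list \<Rightarrow>\<^sub>0 'k) (Poly_Mapping.single x 1) = (\<Sum>w\<in>S. Poly_Mapping.single (w @ x) 1)"
    using assms by (simp add: nc_mult_def keys_word_sum lookup_word_sum)
  then show ?thesis
    by (simp add: word_sum_def sum.reindex inj_on_def)
qed

text \<open>The two branches of the recursion begin with different letters \<open>a\<close> and
  \<open>b\<close>, so their supports are disjoint and no multiplicity arises; the set
  \<open>shuffles\<close> obeys the same recursion.\<close>

lemma shuffle_disjoint:
  assumes "set u \<inter> set v = {}"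
  shows "shuffle u v = (word_sum (shuffles u v) :: 'a list \<Rightarrow>\<^sub>0 'k::comm_semiring_1)"
  using assms
proof (induction u v rule: shuffle.induct)
  case (3 a u b v)
  have "(#) a ` shuffles u (b # v) \<inter> (#) b ` shuffles (a # u) v = {}"
    using 3 by auto
  with 3 show ?case
    by (simp add: nc_mult_single_word_sum word_sum_Un)
qed (simp_all add: word_sum_def)

text \<open>Each letter reveals which factor it came from, so filtering undoes the shuffle.\<close>

lemma in_shuffles_disjoint_iff:
  assumes "set u \<inter> set v = {}"
  shows "w \<in> shuffles u v \<longleftrightarrow>
    filter (\<lambda>x. x \<in> set u) w = u \<and> filter (\<lambda>x. x \<notin> set u) w = v"
  using filter_shuffles_disjoint1[OF assms] partition_in_shuffles[of w "\<lambda>x. x \<in> set u"] by metis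

text \<open>A shuffle ending in a letter of \<open>u\<close> ends in \<open>last u\<close>, since
  its letters from \<open>u\<close> read \<open>u\<close> in order; deleting that letter leaves a
  shuffle of \<open>butlast u\<close> and \<open>v\<close>.\<close>

lemma half_shuffle_disjoint:
  assumes "u \<noteq> []" "set u \<inter> set v = {}"
  shows "u \<prec> v =
    (word_sum {w \<in> shuffles u v. last w \<in> set u} :: 'a list \<Rightarrow>\<^sub>0 'k::comm_semiring_1)"
proof -
  have disj: "set (butlast u) \<inter> set v = {}"
    using assms by (auto dest: in_set_butlastD)
  then have "u \<prec> v = (word_sum ((\<lambda>w. w @ [last u]) ` shuffles (butlast u) v) :: 'a list \<Rightarrow>\<^sub>0 'k)"
    by (simp add: half_shuffle_def shuffle_disjoint nc_mult_word_sum_single)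
  also have "(\<lambda>w. w @ [last u]) ` shuffles (butlast u) v = {w \<in> shuffles u v. last w \<in> set u}"
  proof (intro set_eqI iffI)
    fix w assume "w \<in> (\<lambda>w. w @ [last u]) ` shuffles (butlast u) v"
    then obtain x where w: "w = x @ [last u]" and x: "x \<in> shuffles (butlast u) v" by blast
    \<comment> \<open>The letter \<open>last u\<close> need not occur in \<open>butlast u\<close>,
      so filtering by the two sets could differ in general. On \<open>x\<close> it does not: its
      letters come from \<open>butlast u\<close> and from \<open>v\<close>, which avoids
      \<open>u\<close>.\<close>
    have "y \<in> set u \<longleftrightarrow> y \<in> set (butlast u)" if "y \<in> set x" for y
      using that assms set_shuffles[OF x] by (auto dest: in_set_butlastD)
    then have "filter (\<lambda>y. y \<in> set u) x = butlast u" "filter (\<lambda>y. y \<notin> set u) x = v"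
      using filter_shuffles_disjoint1[OF disj x] by (metis (mono_tags, lifting) filter_cong)+
    then show "w \<in> {w \<in> shuffles u v. last w \<in> set u}"
      using assms by (simp add: w in_shuffles_disjoint_iff)
  next
    fix w assume "w \<in> {w \<in> shuffles u v. last w \<in> set u}"
    then have w: "w \<in> shuffles u v" "last w \<in> set u" by auto
    moreover have "w \<noteq> []" using w assms by auto
    ultimately obtain x a where x: "w = x @ [a]" "a \<in> set u" by (metis append_butlast_last_id)
    then have f: "filter (\<lambda>y. y \<in> set u) x @ [a] = u" "filter (\<lambda>y. y \<notin> set u) x = v"
      using filter_shuffles_disjoint1[OF assms(2) w(1)] by auto
    then have "butlast u = filter (\<lambda>y. y \<in> set u) x" "last u = a"
      by (metis butlast_snoc, metis last_snoc)
    then show "w \<in> (\<lambda>w. w @ [last u]) ` shuffles (butlast u) v"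
      using x f(2) partition_in_shuffles[of x "\<lambda>y. y \<in> set u"] by auto
  qed
  finally show ?thesis .
qed

section \<open>Coefficients as counts of sorted lists of pairs\<close>

text \<open>For neighbouring positions the defining inequalities are the lexicographic order on
  pairs: a tie in \<open>s\<close> is allowed only where \<open>w\<close> does not descend.
  Transitivity passes from neighbours to \<open>sorted\<close>.\<close>

lemma index_seqs_descent_comp:
  "index_seqs (descent_comp w) = {s. length s = length w \<and> sorted (zip s w)}"
proof -
  have "(\<forall>j. 1 \<le> j \<and> j < length w \<longrightarrow>
      s ! (j - 1) \<le> s ! j \<and> (j \<in> descents w \<longrightarrow> s ! (j - 1) < s ! j)) \<longleftrightarrow> sorted (zip s w)"
    (is "?L \<longleftrightarrow> _") if "length s = length w" for s
  proof -
    have "?L \<longleftrightarrow> (\<forall>i. Suc i < length w \<longrightarrow>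
        s ! i \<le> s ! Suc i \<and> (w ! Suc i < w ! i \<longrightarrow> s ! i < s ! Suc i))"
      by (auto simp: descents_def Suc_le_eq gr0_conv_Suc)
    also have "\<dots> \<longleftrightarrow> sorted (zip s w)"
      using that by (auto simp: sorted_iff_nth_Suc less_eq_prod_def not_less le_less)
    finally show ?thesis .
  qed
  then show ?thesis
    using descent_comp[of w] unfolding index_seqs_def is_composition_def
    by (intro Collect_cong conj_cong) simp_all
qed

lemma monomial_of_filter:
  "monomial_of (map f z) =
    monomial_of (map f (filter P z)) + monomial_of (map f (filter (\<lambda>x. \<not> P x) z))"
  by (induction z) (auto simp: monomial_of_def ac_simps)

lemma sorted_last: "sorted xs \<Longrightarrow> x \<in> set xs \<Longrightarrow> x \<le> last xs"
  by (induction xs) auto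

text \<open>A word \<open>w\<close> of \<open>S\<close> and an index sequence \<open>s\<close> for
  it fuse into \<open>zip s w\<close>, from which both are recovered by projection, so the sum over
  \<open>S\<close> becomes one cardinality.\<close>

lemma bracket_word_sum:
  assumes "finite S"
  shows "\<langle>word_sum S :: 'a::linorder list \<Rightarrow>\<^sub>0 'k::comm_semiring_1\<rangle> m =
    of_nat (card {z. sorted z \<and> map snd z \<in> S \<and> monomial_of (map fst z) = m})"
proof -
  let ?F = "\<lambda>w. {s \<in> index_seqs (descent_comp w). monomial_of s = m}"
  let ?Z = "{z. sorted z \<and> map snd z \<in> S \<and> monomial_of (map fst z) = m}"
  have "\<langle>word_sum S :: 'a list \<Rightarrow>\<^sub>0 'k\<rangle> m = (\<Sum>w\<in>S. of_nat (card (?F w)))"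
    using assms by (simp add: bracket_def keys_word_sum lookup_word_sum fundamental_qsym_def)
  also have "\<dots> = of_nat (card (Sigma S ?F))"
    using assms by (simp add: card_SigmaI finite_monomial_fibre)
  also have "bij_betw (\<lambda>(w, s). zip s w) (Sigma S ?F) ?Z"
    by (rule bij_betw_byWitness[where f' = "\<lambda>z. (map snd z, map fst z)"])
      (auto simp: index_seqs_descent_comp zip_map_fst_snd)
  then have "card (Sigma S ?F) = card ?Z"
    by (rule bij_betw_same_card)
  finally show ?thesis .
qed

text \<open>Here the shuffle disappears: the words enter the count only through their descent
  compositions and the order of their last letters. The condition on last entries says that
  \<open>(last g, last v)\<close> lies lexicographically below
  \<open>(last f, last u)\<close>.\<close>

lemma bracket_half_shuffle:
  fixes u v :: "'a::linorder list"
  assumes ne: "u \<noteq> []" "v \<noteq> []" and disj: "set u \<inter> set v = {}"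
  shows "(\<langle>u \<prec> v\<rangle> :: 'k::comm_semiring_1 series) m = of_nat (card {(f, g).
    f \<in> index_seqs (descent_comp u) \<and> g \<in> index_seqs (descent_comp v) \<and>
    (last g < last f \<or> last g = last f \<and> last v < last u) \<and> monomial_of f + monomial_of g = m})"
    (is "_ = of_nat (card ?FG)")
proof -
  let ?Z = "{z. sorted z \<and> map snd z \<in> {w \<in> shuffles u v. last w \<in> set u} \<and>
    monomial_of (map fst z) = m}"
  \<comment> \<open>This set links \<open>?Z\<close> to \<open>?FG\<close>: it is reached by
    splitting a merged list and by zipping index sequences with their words.\<close>
  define PQ where "PQ = {(p :: (nat \<times> 'a) list, q). map snd p = u \<and> map snd q = v \<and>
    sorted p \<and> sorted q \<and> last q < last p \<and> monomial_of (map fst p) + monomial_of (map fst q) = m}"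
  let ?P = "\<lambda>x :: nat \<times> 'a. snd x \<in> set u"
  let ?split = "\<lambda>z. (filter ?P z, filter (\<lambda>x. \<not> ?P x) z)"
  have shuf: "map snd z \<in> shuffles u v \<longleftrightarrow>
      map snd (filter ?P z) = u \<and> map snd (filter (\<lambda>x. \<not> ?P x) z) = v" for z :: "(nat \<times> 'a) list"
    by (simp add: in_shuffles_disjoint_iff[OF disj] filter_map o_def)
  \<comment> \<open>The last entry of a sorted list is its maximum, and likewise for both filtered
    parts. So the final letter lies in \<open>u\<close> iff the maximum of the \<open>u\<close> part
    is the larger; the two maxima cannot be equal, as their letters differ.\<close>
  have last_iff: "last (map snd z) \<in> set u \<longleftrightarrow> last (filter (\<lambda>x. \<not> ?P x) z) < last (filter ?P z)"
    if "sorted z" "map snd z \<in> shuffles u v" for z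
  proof -
    have nep: "filter ?P z \<noteq> []" and neq: "filter (\<lambda>x. \<not> ?P x) z \<noteq> []"
      using that(2) ne unfolding shuf by force+
    from last_in_set[OF nep] have p: "last (filter ?P z) \<in> set z" "?P (last (filter ?P z))" by auto
    from last_in_set[OF neq] have q: "last (filter (\<lambda>x. \<not> ?P x) z) \<in> set z"
      "\<not> ?P (last (filter (\<lambda>x. \<not> ?P x) z))" by auto
    from p have "z \<noteq> []" by auto
    then have z: "last z \<in> set z" "last (map snd z) = snd (last z)"
      by (simp_all add: last_map)
    show ?thesis
    proof (cases "?P (last z)")
      case True
      then have "last z \<le> last (filter ?P z)"
        using z that(1) by (intro sorted_last) (auto intro: sorted_wrt_filter)
      moreover have "last (filter (\<lambda>x. \<not> ?P x) z) < last z"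
        using sorted_last[OF that(1) q(1)] q(2) True by (auto simp: order_less_le)
      ultimately show ?thesis using True z by (simp add: order_less_le_trans)
    next
      case False
      then have "last z \<le> last (filter (\<lambda>x. \<not> ?P x) z)"
        using z that(1) by (intro sorted_last) (auto intro: sorted_wrt_filter)
      moreover have "last (filter ?P z) \<le> last z"
        using sorted_last[OF that(1) p(1)] .
      ultimately show ?thesis using False z by (simp add: not_less order_trans)
    qed
  qed
  have "bij_betw ?split ?Z PQ"
  \<comment> \<open>Merging by \<open>sort\<close> inverts splitting, because a sorted list is
    determined by its multiset of entries.\<close>
  proof (rule bij_betw_byWitness[where f' = "\<lambda>(p, q). sort (p @ q)"])
    show "\<forall>z\<in>?Z. (case ?split z of (p, q) \<Rightarrow> sort (p @ q)) = z"
      by (auto intro!: properties_for_sort)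
    \<comment> \<open>\<open>filter\<close> commutes with \<open>sort\<close>, and the letters tell
      the entries of \<open>p\<close> from those of \<open>q\<close>.\<close>
    have split_sort: "?split (sort (p @ q)) = (p, q)" if "(p, q) \<in> PQ" for p q
    proof -
      have "snd ` set p = set u" "snd ` set q = set v"
        using that unfolding PQ_def by (metis (mono_tags, lifting) case_prodD mem_Collect_eq set_map)+
      then have "\<forall>x\<in>set p. ?P x" "\<forall>x\<in>set q. \<not> ?P x"
        using disj by blast+
      then show ?thesis
        using that by (simp add: filter_sort sorted_sort_id PQ_def)
    qed
    then show "\<forall>x\<in>PQ. ?split (case x of (p, q) \<Rightarrow> sort (p @ q)) = x" by auto
    show "?split ` ?Z \<subseteq> PQ"
    proof
      fix x assume "x \<in> ?split ` ?Z"
      then obtain z where x: "x = ?split z" and z: "z \<in> ?Z" by blast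
      then have sh: "map snd z \<in> shuffles u v" and so: "sorted z" by auto
      have "last (filter (\<lambda>x. \<not> ?P x) z) < last (filter ?P z)"
        using last_iff[OF so sh] z by simp
      moreover have "monomial_of (map fst (filter ?P z)) +
          monomial_of (map fst (filter (\<lambda>x. \<not> ?P x) z)) = m"
        using monomial_of_filter[of fst z ?P] z by simp
      ultimately show "x \<in> PQ"
        using sh so unfolding shuf PQ_def x by (simp add: sorted_wrt_filter)
    qed
    show "(\<lambda>(p, q). sort (p @ q)) ` PQ \<subseteq> ?Z"
    proof (rule image_subsetI)
      fix x assume "x \<in> PQ"
      then obtain p q where x: "x = (p, q)" and pq: "(p, q) \<in> PQ" by (cases x) auto
      let ?z = "sort (p @ q)"
      have s: "filter ?P ?z = p" "filter (\<lambda>x. \<not> ?P x) ?z = q" using split_sort[OF pq] by auto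
      have "sorted ?z" by simp
      moreover have sh: "map snd ?z \<in> shuffles u v"
        using pq unfolding shuf s by (simp add: PQ_def)
      moreover have "last (map snd ?z) \<in> set u"
        using pq last_iff[OF \<open>sorted ?z\<close> sh] unfolding s by (simp add: PQ_def)
      moreover have "monomial_of (map fst ?z) = m"
        using pq monomial_of_filter[of fst ?z ?P] unfolding s by (simp add: PQ_def)
      ultimately show "(case x of (p, q) \<Rightarrow> sort (p @ q)) \<in> ?Z" by (simp add: x)
    qed
  qed
  then have card_Z: "card ?Z = card PQ" by (rule bij_betw_same_card)
  have last_less_iff: "last (zip g v) < last (zip f u) \<longleftrightarrow>
      last g < last f \<or> last g = last f \<and> last v < last u"
    if "length f = length u" "length g = length v" for f g :: "nat list"
  proof -
    have "f \<noteq> []" "g \<noteq> []" using that ne by auto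
    then show ?thesis using that ne by (auto simp: last_zip)
  qed
  have "bij_betw (\<lambda>(f, g). (zip f u, zip g v)) ?FG PQ"
  proof (rule bij_betw_byWitness[where f' = "\<lambda>(p, q). (map fst p, map fst q)"])
    show "(\<lambda>(f, g). (zip f u, zip g v)) ` ?FG \<subseteq> PQ"
    proof (rule image_subsetI)
      fix x assume "x \<in> ?FG"
      then show "(case x of (f, g) \<Rightarrow> (zip f u, zip g v)) \<in> PQ"
        by (cases x) (simp add: PQ_def index_seqs_descent_comp last_less_iff)
    qed
    show "(\<lambda>(p, q). (map fst p, map fst q)) ` PQ \<subseteq> ?FG"
    proof (rule image_subsetI)
      fix x assume "x \<in> PQ"
      then obtain p q where x: "x = (p, q)" and pq: "(p, q) \<in> PQ" by (cases x) auto
      then have "map snd p = u" "map snd q = v" by (auto simp: PQ_def)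
      then have "zip (map fst p) u = p" "zip (map fst q) v = q"
        and len: "length (map fst p) = length u" "length (map fst q) = length v"
        by (auto simp: zip_map_fst_snd)
      then show "(case x of (p, q) \<Rightarrow> (map fst p, map fst q)) \<in> ?FG"
        using pq last_less_iff[OF len] by (simp add: x PQ_def index_seqs_descent_comp)
    qed
  qed (auto simp: PQ_def index_seqs_descent_comp zip_map_fst_snd)
  then have "card ?FG = card PQ" by (rule bij_betw_same_card)
  with card_Z show ?thesis
    by (simp add: half_shuffle_disjoint[OF ne(1) disj] bracket_word_sum del: mem_Collect_eq)
qed

text \<open>\<open>descent_comp\<close> is built from length and descent set alone, so both
  coefficients are the same count. The two type variables let words over any alphabet be compared
  with words of numbers.\<close>

lemma bracket_half_shuffle_cong:
  fixes u v :: "'a::linorder list" and u' v' :: "'b::linorder list"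
  assumes "u \<noteq> []" "v \<noteq> []" "set u \<inter> set v = {}" "set u' \<inter> set v' = {}"
    and "length u = length u'" "length v = length v'"
    and "descents u = descents u'" "descents v = descents v'"
    and "last v < last u \<longleftrightarrow> last v' < last u'"
  shows "\<langle>u \<prec> v\<rangle> = (\<langle>u' \<prec> v'\<rangle> :: 'k::comm_semiring_1 series)"
proof
  fix m
  have "u' \<noteq> []" "v' \<noteq> []" using assms by auto
  then show "\<langle>u \<prec> v\<rangle> m = (\<langle>u' \<prec> v'\<rangle> :: 'k series) m"
    using assms by (simp add: bracket_half_shuffle descent_comp_def)
qed

section \<open>Descents and labels of the standardized word\<close>

text \<open>Labels are cardinalities of the sets \<open>?L\<close>, which are nested. At a descent
  \<open>?L j\<close> is strictly inside \<open>?L i\<close>, as \<open>i\<close> belongs only to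
  the latter; otherwise \<open>?L i\<close> is inside \<open>?L j\<close>, ties being settled by
  position.\<close>

lemma std_less_iff:
  assumes "i < j" "j < length w"
  shows "std w ! j < std w ! i \<longleftrightarrow> w ! j < w ! i"
proof -
  let ?L = "\<lambda>i. {j. j < length w \<and> (w ! j < w ! i \<or> w ! j = w ! i \<and> j \<le> i)}"
  have nth: "std w ! i = card (?L i)" if "i < length w" for i
    using that by (simp add: std_def)
  have "?L j \<subset> ?L i" if "w ! j < w ! i"
  proof
    show "?L j \<subseteq> ?L i" using that by auto
    show "?L j \<noteq> ?L i" using assms that by (auto simp: set_eq_iff intro!: exI[of _ i])
  qed
  then have "w ! j < w ! i \<Longrightarrow> card (?L j) < card (?L i)"
    by (intro psubset_card_mono) auto
  moreover have "card (?L i) \<le> card (?L j)" if "\<not> w ! j < w ! i"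
    using assms that by (intro card_mono) auto
  ultimately show ?thesis
    using assms by (auto simp: nth simp flip: not_less)
qed

lemma length_std [simp]: "length (std w) = length w"
  by (simp add: std_def)

lemma descents_std: "descents (std w) = descents w"
  by (auto simp: descents_def std_less_iff)

lemma descents_shift: "descents (shift w k) = descents w"
  by (auto simp: descents_def shift_def)

text \<open>Every position counts itself, whence the lower bound. The bounds ensure that shifting by
  the length of the other word separates the two alphabets.\<close>

lemma set_std: "set (std w) \<subseteq> {1..length w}"
proof -
  have "card {j. j < length w \<and> (w ! j < w ! i \<or> w ! j = w ! i \<and> j \<le> i)} \<in> {1..length w}" (is "card ?L \<in> _")
    if "i < length w" for i
  proof -
    have "card ?L \<le> card {..<length w}" by (rule card_mono) auto
    moreover have "i \<in> ?L" using that by auto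
    then have "0 < card ?L" by (subst card_gt_0_iff) auto
    ultimately show ?thesis by (simp only: atLeastAtMost_iff card_lessThan Suc_le_eq One_nat_def)
  qed
  then show ?thesis by (auto simp: std_def)
qed

lemma length_shift [simp]: "length (shift w k) = length w"
  by (simp add: shift_def)

lemma set_shift: "set (shift w k) = (\<lambda>a. a + k) ` set w"
  by (simp add: shift_def)

theorem theorem4p2:
  fixes u v :: "'a::linorder list"
  assumes "u \<noteq> []" and "v \<noteq> []"
    and "set u \<inter> set v = {}"
  shows "(last u < last v \<longrightarrow>
            \<langle>u \<prec> v\<rangle> = (\<langle>std u \<prec> shift (std v) (length u)\<rangle> :: 'k::field series)) \<and>
         (last u > last v \<longrightarrow>
            \<langle>u \<prec> v\<rangle> = (\<langle>shift (std u) (length v) \<prec> std v\<rangle> :: 'k series))"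
proof (intro conjI impI)
  \<comment> \<open>Labels of \<open>w\<close> are at most \<open>length w\<close>, while shifted
    labels exceed it. This gives both the disjointness of the new alphabets and the order of their
    last letters.\<close>
  have less: "x < y" if "x \<in> set (std w)" "y \<in> set (shift (std w') (length w))"
    for x y and w w' :: "'a list"
    using that set_std[of w] set_std[of w'] by (fastforce simp: set_shift)
  have ne: "std u \<noteq> []" "std v \<noteq> []" "shift (std u) (length v) \<noteq> []" "shift (std v) (length u) \<noteq> []"
    using assms by (simp_all add: std_def shift_def)
  {
    assume "last u < last v"
    \<comment> \<open>In this case the comparison required by
      \<open>bracket_half_shuffle_cong\<close> is false on both sides.\<close>
    moreover have "last (std u) < last (shift (std v) (length u))"
      using ne by (intro less[of _ u _ v]) auto
    ultimately show "\<langle>u \<prec> v\<rangle> = (\<langle>std u \<prec> shift (std v) (length u)\<rangle> :: 'k series)"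
      using assms less[of _ u _ v]
      by (intro bracket_half_shuffle_cong) (auto simp: descents_std descents_shift)
  }
  {
    assume "last u > last v"
    \<comment> \<open>In this case the same comparison is true on both sides.\<close>
    moreover have "last (std v) < last (shift (std u) (length v))"
      using ne by (intro less[of _ v _ u]) auto
    ultimately show "\<langle>u \<prec> v\<rangle> = (\<langle>shift (std u) (length v) \<prec> std v\<rangle> :: 'k series)"
      using assms less[of _ v _ u]
      by (intro bracket_half_shuffle_cong) (auto simp: descents_std descents_shift)
  }
qed

end
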